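(* For every integer $n\geq 3$, writing $f_q(n)$ for the total number of occurrences of the pattern $q$ in all permutations of $S_n(132,213)$, we have $$f_{123}(n)=(n-4)2^{n-1}+n+2,$$ $$f_{231}(n)=f_{312}(n)=(n^2-7n+16)2^{n-2}-n-4,$$ $$f_{321}(n)=\left(\frac{n^3}{3}-3n^2+\frac{38n}{3}-24\right)2^{n-2}+n+6.$$
   Context: $S_n$ is the set of permutations of $\{1,\dots,n\}$ written in one-line notation $\sigma=\sigma_1\sigma_2\cdots\sigma_n$. For $q\in S_k$, an occurrence of the pattern $q$ in $\sigma\in S_n$ is a choice of indices $i_1<i_2<\cdots<i_k$ in $\{1,\dots,n\}$ such that for all $1\le j,l\le k$, $q_j<q_l$ if and only if $\sigma_{i_j}<\sigma_{i_l}$. Let $f_q(\sigma)$ be the number of occurrences of $q$ in $\sigma$; $\sigma$ avoids $q$ if $f_q(\sigma)=0$. $S_n(132,213)$ is the set of permutations in $S_n$ avoiding both $132$ and $213$, and $f_q(n)=\sum_{\sigma\in S_n(132,213)}f_q(\sigma)$. *)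

theory Defs
  imports Complex_Main "HOL-Combinatorics.Multiset_Permutations"
begin

text \<open>
  A permutation in one-line notation is a list, so \<open>S\<^sub>n\<close> is \<open>permutations_of_set {1..n}\<close>:
  the values are \<open>1, \<dots>, n\<close>, but the positions are \<open>0, \<dots>, n - 1\<close>, as list indexing
  starts at 0.  An occurrence of a pattern is recorded as the increasing list of the
  chosen positions.
\<close>

definition occurrences :: "nat list \<Rightarrow> nat list \<Rightarrow> nat list set" where
  "occurrences q \<sigma> =
     {is. length is = length q \<and> sorted_wrt (<) is \<and> set is \<subseteq> {..<length \<sigma>} \<and>
          (\<forall>j<length q. \<forall>l<length q. q ! j < q ! l \<longleftrightarrow> \<sigma> ! (is ! j) < \<sigma> ! (is ! l))}"

definition occ_count :: "nat list \<Rightarrow> nat list \<Rightarrow> nat" where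
  "occ_count q \<sigma> = card (occurrences q \<sigma>)"

definition avoids :: "nat list \<Rightarrow> nat list \<Rightarrow> bool" where
  "avoids \<sigma> q \<longleftrightarrow> occ_count q \<sigma> = 0"

lemma finite_occurrences: "finite (occurrences q \<sigma>)"
  by (rule finite_subset[OF _ finite_lists_length_eq[of "{..<length \<sigma>}" "length q"]])
    (auto simp: occurrences_def)

definition avoiders :: "nat \<Rightarrow> nat list set" where
  "avoiders n = {\<sigma> \<in> permutations_of_set {1..n}. avoids \<sigma> [1,3,2] \<and> avoids \<sigma> [2,1,3]}"

definition total_occ :: "nat list \<Rightarrow> nat \<Rightarrow> nat" where
  "total_occ q n = (\<Sum>\<sigma>\<in>avoiders n. occ_count q \<sigma>)"

end

theory Submission
  imports Defs
begin

text \<open>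
  A permutation avoiding 132 and 213 is a sequence of runs of consecutive increasing values in
  which every run lies above the next one.  It is therefore determined by its descent set, which
  can be any subset \<open>S\<close> of the \<open>n - 1\<close> possible descent positions, and two entries
  at positions \<open>a < b\<close> are in increasing order iff \<open>S\<close> is disjoint from \<open>{a..<b}\<close>.
  For fixed \<open>a < b\<close> this happens for \<open>2 ^ (n - 1) * 2 ^ a / 2 ^ b\<close> of the subsets, so,
  summing over the position triples \<open>i < j < l\<close> first, inclusion-exclusion reduces all
  four totals to geometric sums.
\<close>

section \<open>Occurrences of patterns of length three\<close>

text \<open>The last position comes first, so that each position bounds the range of the next and a
  sum over the set becomes nested sums over initial segments, open to induction.\<close>

definition triples :: "nat \<Rightarrow> (nat \<times> nat \<times> nat) set" where
  "triples n = (SIGMA l:{..<n}. SIGMA j:{..<l}. {..<j})"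

lemma finite_triples [simp]: "finite (triples n)"
  by (simp add: triples_def)

lemma sum_triples:
  "(\<Sum>(l, j, i)\<in>triples n. f l j i) = (\<Sum>l<n. \<Sum>j<l. \<Sum>i<j. f l j i)"
  by (simp add: triples_def sum.Sigma split_beta)

definition has_order :: "nat list \<Rightarrow> nat list \<Rightarrow> nat \<times> nat \<times> nat \<Rightarrow> bool" where
  "has_order q \<sigma> = (\<lambda>(l, j, i).
     (q ! 0 < q ! 1 \<longleftrightarrow> \<sigma> ! i < \<sigma> ! j) \<and>
     (q ! 1 < q ! 2 \<longleftrightarrow> \<sigma> ! j < \<sigma> ! l) \<and>
     (q ! 0 < q ! 2 \<longleftrightarrow> \<sigma> ! i < \<sigma> ! l))"

text \<open>Distinctness makes each reversed comparison the negation of the direct one, and equal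
  indices compare trivially, so three of the nine index pairs decide.\<close>

lemma order3_iff:
  fixes a b c x y z :: nat
  assumes "a \<noteq> b" "b \<noteq> c" "a \<noteq> c" "x \<noteq> y" "y \<noteq> z" "x \<noteq> z"
  shows "(\<forall>u<3. \<forall>v<3. [a, b, c] ! u < [a, b, c] ! v \<longleftrightarrow> [x, y, z] ! u < [x, y, z] ! v) \<longleftrightarrow>
    (a < b \<longleftrightarrow> x < y) \<and> (b < c \<longleftrightarrow> y < z) \<and> (a < c \<longleftrightarrow> x < z)"
proof -
  have lt3: "(\<forall>u<3. P u) \<longleftrightarrow> P 0 \<and> P 1 \<and> P 2" for P :: "nat \<Rightarrow> bool"
    by (auto simp: numeral_3_eq_3 numeral_2_eq_2 less_Suc_eq)
  have "b < a \<longleftrightarrow> \<not> a < b" "c < b \<longleftrightarrow> \<not> b < c" "c < a \<longleftrightarrow> \<not> a < c"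
    "y < x \<longleftrightarrow> \<not> x < y" "z < y \<longleftrightarrow> \<not> y < z" "z < x \<longleftrightarrow> \<not> x < z"
    using assms by auto
  then show ?thesis
    by (simp add: lt3) blast
qed

lemma occurrences_length_3:
  assumes "length q = 3" "distinct q" "distinct \<sigma>"
  shows "occurrences q \<sigma> =
    (\<lambda>(l, j, i). [i, j, l]) ` {t \<in> triples (length \<sigma>). has_order q \<sigma> t}"
proof -
  obtain a b c where [simp]: "q = [a, b, c]"
    using assms(1) by (auto simp: numeral_3_eq_3 length_Suc_conv)
  have order: "(\<forall>x<3. \<forall>y<3. q ! x < q ! y \<longleftrightarrow> \<sigma> ! ([i, j, l] ! x) < \<sigma> ! ([i, j, l] ! y))
      \<longleftrightarrow> has_order q \<sigma> (l, j, i)" if "i < j" "j < l" "l < length \<sigma>" for i j l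
  proof -
    \<comment> \<open>Moves \<open>\<sigma> !\<close> inside the index list, so that
      \<open>order3_iff\<close> applies to the list of the three entries.\<close>
    have nth: "\<sigma> ! ([i, j, l] ! x) = [\<sigma> ! i, \<sigma> ! j, \<sigma> ! l] ! x" if "x < 3" for x
      using that nth_map[of x "[i, j, l]" "(!) \<sigma>"] by simp
    have "\<sigma> ! i \<noteq> \<sigma> ! j" "\<sigma> ! j \<noteq> \<sigma> ! l" "\<sigma> ! i \<noteq> \<sigma> ! l"
      using that assms(3) by (simp_all add: nth_eq_iff_index_eq)
    moreover have "a \<noteq> b" "b \<noteq> c" "a \<noteq> c"
      using assms(2) by simp_all
    ultimately show ?thesis
      using order3_iff[of a b c "\<sigma> ! i" "\<sigma> ! j" "\<sigma> ! l"] by (simp add: nth has_order_def)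
  qed
  show ?thesis
  proof (intro set_eqI iffI)
    fix xs assume xs: "xs \<in> occurrences q \<sigma>"
    then have "length xs = 3" by (simp add: occurrences_def assms)
    then obtain i j l where [simp]: "xs = [i, j, l]"
      by (auto simp: numeral_3_eq_3 length_Suc_conv)
    have "i < j" "j < l" "l < length \<sigma>"
      using xs by (auto simp: occurrences_def)
    with xs order[of i j l]
    have "(l, j, i) \<in> {t \<in> triples (length \<sigma>). has_order q \<sigma> t}"
      by (simp add: occurrences_def assms(1) triples_def)
    then show "xs \<in> (\<lambda>(l, j, i). [i, j, l]) ` {t \<in> triples (length \<sigma>). has_order q \<sigma> t}"
      by (force intro: image_eqI[where x = "(l, j, i)"])
  next
    fix xs assume "xs \<in> (\<lambda>(l, j, i). [i, j, l]) ` {t \<in> triples (length \<sigma>). has_order q \<sigma> t}"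
    then obtain i j l where "xs = [i, j, l]" "(l, j, i) \<in> triples (length \<sigma>)"
      and "has_order q \<sigma> (l, j, i)"
      by auto
    moreover from this have "i < j" "j < l" "l < length \<sigma>"
      by (auto simp: triples_def)
    ultimately show "xs \<in> occurrences q \<sigma>"
      using order[of i j l] by (simp add: occurrences_def assms(1))
  qed
qed

lemma occ_count_length_3:
  assumes "length q = 3" "distinct q" "distinct \<sigma>"
  shows "occ_count q \<sigma> = card {t \<in> triples (length \<sigma>). has_order q \<sigma> t}"
  unfolding occ_count_def occurrences_length_3[OF assms]
  by (rule card_image) (auto simp: inj_on_def)

lemma avoids_length_3:
  assumes "length q = 3" "distinct q" "distinct \<sigma>"
  shows "avoids \<sigma> q \<longleftrightarrow> (\<forall>l<length \<sigma>. \<forall>j<l. \<forall>i<j. \<not> has_order q \<sigma> (l, j, i))"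
  unfolding avoids_def occ_count_length_3[OF assms]
  by (auto simp: triples_def)

section \<open>Descent sets\<close>

definition descents :: "nat list \<Rightarrow> nat set" where
  "descents \<sigma> = {i. Suc i < length \<sigma> \<and> \<sigma> ! Suc i < \<sigma> ! i}"

text \<open>An occurrence of 132 or 213 is a triple with ascending outer entries whose middle entry
  lies above both or below both. Avoiding the two patterns together confines the middle entry to the
  gap between the outer ones.\<close>

lemma avoiders_iff:
  "\<sigma> \<in> avoiders n \<longleftrightarrow> distinct \<sigma> \<and> length \<sigma> = n \<and> set \<sigma> = {1..n} \<and>
     (\<forall>l<n. \<forall>j<l. \<forall>i<j. \<sigma> ! i < \<sigma> ! l \<longrightarrow> \<sigma> ! i < \<sigma> ! j \<and> \<sigma> ! j < \<sigma> ! l)"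
proof (cases "distinct \<sigma> \<and> set \<sigma> = {1..n}")
  case True
  then have len: "length \<sigma> = n"
    using distinct_card[of \<sigma>] by simp
  have neq: "\<sigma> ! i \<noteq> \<sigma> ! j \<and> \<sigma> ! j \<noteq> \<sigma> ! l \<and> \<sigma> ! i \<noteq> \<sigma> ! l" if "i < j" "j < l" "l < n" for i j l
    using that True len by (simp add: nth_eq_iff_index_eq)
  have no132: "avoids \<sigma> [1, 3, 2] \<longleftrightarrow> (\<forall>l<n. \<forall>j<l. \<forall>i<j. \<not> has_order [1, 3, 2] \<sigma> (l, j, i))"
    and no213: "avoids \<sigma> [2, 1, 3] \<longleftrightarrow> (\<forall>l<n. \<forall>j<l. \<forall>i<j. \<not> has_order [2, 1, 3] \<sigma> (l, j, i))"
    using avoids_length_3[of _ \<sigma>] True len by simp_all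
  have "(\<not> has_order [1, 3, 2] \<sigma> (l, j, i) \<and> \<not> has_order [2, 1, 3] \<sigma> (l, j, i)) \<longleftrightarrow>
      (\<sigma> ! i < \<sigma> ! l \<longrightarrow> \<sigma> ! i < \<sigma> ! j \<and> \<sigma> ! j < \<sigma> ! l)" if "i < j" "j < l" "l < n" for i j l
    using neq[OF that] by (auto simp: has_order_def)
  then show ?thesis
    unfolding avoiders_def permutations_of_set_def no132 no213 mem_Collect_eq
    using True len by (simp add: no132 no213) blast
next
  case False
  then show ?thesis
    by (auto simp: avoiders_def permutations_of_set_def)
qed

text \<open>If the outer entries ascend, the betweenness property of \<open>avoiders_iff\<close>
  forces every step in between to ascend; conversely, ascending steps chain together.\<close>

lemma avoider_less_iff:
  assumes "\<sigma> \<in> avoiders n" "i < j" "j < n"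
  shows "\<sigma> ! i < \<sigma> ! j \<longleftrightarrow> descents \<sigma> \<inter> {i..<j} = {}"
proof
  have \<sigma>: "distinct \<sigma>" "length \<sigma> = n"
    and mid: "\<And>i j l. \<lbrakk>l < n; j < l; i < j; \<sigma> ! i < \<sigma> ! l\<rbrakk> \<Longrightarrow> \<sigma> ! i < \<sigma> ! j \<and> \<sigma> ! j < \<sigma> ! l"
    using assms(1) unfolding avoiders_iff by blast+
  {
    assume less: "\<sigma> ! i < \<sigma> ! j"
    have "\<sigma> ! k < \<sigma> ! Suc k" if "i \<le> k" "k < j" for k
    proof -
      \<comment> \<open>Betweenness is used twice: for the positions \<open>i\<close>,
        \<open>k\<close>, \<open>j\<close>, and then for \<open>k\<close>, \<open>Suc k\<close>,
        \<open>j\<close>.\<close>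
      have "\<sigma> ! k < \<sigma> ! j"
        using mid[of j k i] that less assms by (cases "k = i") auto
      then show ?thesis
        using mid[of j "Suc k" k] that assms by (cases "Suc k = j") auto
    qed
    then show "descents \<sigma> \<inter> {i..<j} = {}"
      by (force simp: descents_def)
  }
  {
    assume "descents \<sigma> \<inter> {i..<j} = {}"
    with assms(2,3) show "\<sigma> ! i < \<sigma> ! j"
    proof (induction j)
      case (Suc j)
      have "\<not> \<sigma> ! Suc j < \<sigma> ! j"
        using Suc.prems \<sigma> by (auto simp: descents_def)
      moreover have "\<sigma> ! Suc j \<noteq> \<sigma> ! j"
        using Suc.prems \<sigma> by (simp add: nth_eq_iff_index_eq)
      ultimately have step: "\<sigma> ! j < \<sigma> ! Suc j" by simp
      show ?case
      proof (cases "i = j")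
        case False
        then have "\<sigma> ! i < \<sigma> ! j"
          using Suc.prems by (intro Suc.IH) (auto simp: atLeastLessThanSuc)
        with step show ?thesis by simp
      qed (use step in simp)
    qed simp
  }
qed

section \<open>Recovering a permutation from its descent set\<close>

text \<open>As the values fill \<open>{1..n}\<close>, each entry equals its own rank, so comparisons
  alone determine the permutation.\<close>

lemma nth_eq_card_le:
  assumes "distinct \<sigma>" "length \<sigma> = n" "set \<sigma> = {1..n}" "i < n"
  shows "\<sigma> ! i = card {j. j < n \<and> \<sigma> ! j \<le> \<sigma> ! i}"
proof -
  have "(!) \<sigma> ` {j. j < n \<and> \<sigma> ! j \<le> \<sigma> ! i} = {x \<in> set \<sigma>. x \<le> \<sigma> ! i}"
    using assms(2) by (auto simp: in_set_conv_nth)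
  also have "\<dots> = {1..\<sigma> ! i}"
    using nth_mem[of i \<sigma>] assms by auto
  finally have "card ((!) \<sigma> ` {j. j < n \<and> \<sigma> ! j \<le> \<sigma> ! i}) = \<sigma> ! i"
    by simp
  moreover have "inj_on ((!) \<sigma>) {j. j < n \<and> \<sigma> ! j \<le> \<sigma> ! i}"
    using assms(1,2) by (auto simp: inj_on_def nth_eq_iff_index_eq)
  ultimately show ?thesis
    by (simp add: card_image)
qed

text \<open>Equal descent sets give equal comparisons by \<open>avoider_less_iff\<close>, and these
  fix every entry as its rank.\<close>

lemma inj_on_descents: "inj_on descents (avoiders n)"
proof (rule inj_onI)
  fix \<sigma> \<tau> assume \<sigma>: "\<sigma> \<in> avoiders n" and \<tau>: "\<tau> \<in> avoiders n" and eq: "descents \<sigma> = descents \<tau>"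
  have less_iff: "\<sigma> ! i < \<sigma> ! j \<longleftrightarrow> \<tau> ! i < \<tau> ! j" if "i < j" "j < n" for i j
    using avoider_less_iff[OF \<sigma> that] avoider_less_iff[OF \<tau> that] eq by simp
  have props: "distinct \<sigma>" "length \<sigma> = n" "set \<sigma> = {1..n}"
    "distinct \<tau>" "length \<tau> = n" "set \<tau> = {1..n}"
    using \<sigma> \<tau> by (simp_all add: avoiders_iff)
  \<comment> \<open>Ranks involve arbitrary pairs of positions, so \<open>less_iff\<close> is
    extended beyond \<open>i < j\<close>; distinctness covers the reversed pairs.\<close>
  have le: "\<sigma> ! j \<le> \<sigma> ! i \<longleftrightarrow> \<tau> ! j \<le> \<tau> ! i" if "i < n" "j < n" for i j
  proof (cases i j rule: linorder_cases)
    case less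
    then show ?thesis using \<open>j < n\<close> by (simp add: less_iff flip: not_less)
  next
    case greater
    moreover have "\<sigma> ! i \<noteq> \<sigma> ! j" "\<tau> ! i \<noteq> \<tau> ! j"
      using greater that props by (simp_all add: nth_eq_iff_index_eq)
    ultimately show ?thesis using less_iff[of j i] that by linarith
  qed simp
  have "\<sigma> ! i = \<tau> ! i" if "i < n" for i
  proof -
    have "{j. j < n \<and> \<sigma> ! j \<le> \<sigma> ! i} = {j. j < n \<and> \<tau> ! j \<le> \<tau> ! i}"
      using le that by blast
    then show ?thesis
      using nth_eq_card_le[of \<sigma> n i] nth_eq_card_le[of \<tau> n i] props that by metis
  qed
  then show "\<sigma> = \<tau>"
    using props by (simp add: nth_equalityI)
qed

section \<open>Realising every descent set\<close>

text \<open>The order on positions in which the corresponding entries increase.\<close>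

definition pos_le :: "nat set \<Rightarrow> nat \<Rightarrow> nat \<Rightarrow> bool" where
  "pos_le S p q \<longleftrightarrow> (if p \<le> q then S \<inter> {p..<q} = {} else S \<inter> {q..<p} \<noteq> {})"

lemma pos_le_total: "pos_le S p q \<or> pos_le S q p"
  by (auto simp: pos_le_def)

lemma pos_le_antisym: "pos_le S p q \<Longrightarrow> pos_le S q p \<Longrightarrow> p = q"
  by (auto simp: pos_le_def split: if_splits)

text \<open>For each relative order of \<open>p\<close>, \<open>q\<close>, \<open>r\<close>, the
  longest interval is cut at the middle point. It misses \<open>S\<close> iff both pieces do, and
  the rest is propositional.\<close>

lemma pos_le_trans:
  assumes "pos_le S p q" "pos_le S q r"
  shows "pos_le S p r"
proof -
  have split: "S \<inter> {a..<c} = {} \<longleftrightarrow> S \<inter> {a..<b} = {} \<and> S \<inter> {b..<c} = {}"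
    if "a \<le> b" "b \<le> c" for a b c
    using ivl_disj_un_two(3)[OF that] by blast
  define c where "c a b \<longleftrightarrow> S \<inter> {a..<b} = {}" for a b
  have "c p r" if "p \<le> r"
    using assms that split[of p q r] split[of p r q] split[of q p r] linorder_le_cases[of p q]
      linorder_le_cases[of q r]
    unfolding pos_le_def c_def[symmetric] by (auto split: if_splits)
  moreover have "\<not> c r p" if "\<not> p \<le> r"
    using assms that split[of q r p] split[of r p q] split[of r q p] linorder_le_cases[of p q]
      linorder_le_cases[of q r]
    unfolding pos_le_def c_def[symmetric] by (auto split: if_splits)
  ultimately show ?thesis
    by (simp add: pos_le_def c_def)
qed

text \<open>The witness gives each position its rank in the total order
  \<open>pos_le S\<close>.\<close>

lemma descents_surj:
  assumes "S \<subseteq> {..<n - 1}"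
  shows "\<exists>\<sigma>\<in>avoiders n. descents \<sigma> = S"
proof -
  \<comment> \<open>The count includes \<open>q\<close> itself, so ranks start at 1.\<close>
  define r where "r q = card {p. p < n \<and> pos_le S p q}" for q
  define \<sigma> where "\<sigma> = map r [0..<n]"
  have refl: "pos_le S p p" for p
    by (simp add: pos_le_def)
  have less: "r p < r q" if "p < n" "q < n" "pos_le S p q" "p \<noteq> q" for p q
    unfolding r_def
  \<comment> \<open>Transitivity gives the inclusion of the down-sets; it is strict because
    \<open>q\<close> lies only in its own, by antisymmetry.\<close>
  proof (rule psubset_card_mono)
    have "\<not> pos_le S q p"
      using that pos_le_antisym by blast
    moreover have "{x. x < n \<and> pos_le S x p} \<subseteq> {x. x < n \<and> pos_le S x q}"
      using that(3) pos_le_trans by blast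
    ultimately show "{x. x < n \<and> pos_le S x p} \<subset> {x. x < n \<and> pos_le S x q}"
      using that(2) refl by blast
  qed simp
  have less_iff: "r p < r q \<longleftrightarrow> S \<inter> {p..<q} = {}" if "p < q" "q < n" for p q
  proof -
    have "pos_le S p q \<longleftrightarrow> S \<inter> {p..<q} = {}" "pos_le S q p \<longleftrightarrow> S \<inter> {p..<q} \<noteq> {}"
      using that by (simp_all add: pos_le_def)
    then show ?thesis
      using less[of p q] less[of q p] that by (cases "S \<inter> {p..<q} = {}") simp_all
  qed
  have inj: "inj_on r {..<n}"
    by (rule inj_onI) (metis less lessThan_iff less_irrefl pos_le_total)
  have "r ` {..<n} \<subseteq> {1..n}"
  proof
    fix x assume "x \<in> r ` {..<n}"
    then obtain q where q: "q < n" "x = r q" by auto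
    have "0 < r q"
      unfolding r_def using q refl by (subst card_gt_0_iff) auto
    moreover have "r q \<le> card {..<n}"
      unfolding r_def by (rule card_mono) auto
    ultimately show "x \<in> {1..n}"
      using q by simp
  qed
  \<comment> \<open>Here \<open>n\<close> distinct ranks lie among \<open>n\<close> values and so
    fill them.\<close>
  then have "r ` {..<n} = {1..n}"
    by (intro card_subset_eq) (simp_all add: card_image[OF inj])
  \<comment> \<open>Through \<open>less_iff\<close>, the avoidance condition says that subintervals
    of an interval missing \<open>S\<close> miss \<open>S\<close> too.\<close>
  then have "\<sigma> \<in> avoiders n"
    using inj less_iff unfolding avoiders_iff
    by (auto simp: \<sigma>_def distinct_map atLeast0LessThan disjoint_iff)
  moreover have "descents \<sigma> = S"
  proof (intro set_eqI)
    fix i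
    show "i \<in> descents \<sigma> \<longleftrightarrow> i \<in> S"
    proof (cases "Suc i < n")
      case True
      then have "r i \<noteq> r (Suc i)"
        using inj by (simp add: inj_on_eq_iff)
      then show ?thesis
        using True less_iff[of i "Suc i"] by (auto simp: descents_def \<sigma>_def)
    next
      case False
      then show ?thesis
        using assms by (auto simp: descents_def \<sigma>_def)
    qed
  qed
  ultimately show ?thesis by blast
qed

lemma bij_betw_descents: "bij_betw descents (avoiders n) (Pow {..<n - 1})"
  unfolding bij_betw_def
proof (intro conjI inj_on_descents subset_antisym subsetI)
  fix S assume "S \<in> descents ` avoiders n"
  then show "S \<in> Pow {..<n - 1}"
    by (auto simp: descents_def avoiders_iff)
next
  fix S assume "S \<in> Pow {..<n - 1}"
  then show "S \<in> descents ` avoiders n"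
    using descents_surj[of S n] by auto
qed

section \<open>Summing over position triples\<close>

text \<open>Double counting: the order of a triple depends on the permutation only through its
  descent set, so the sum is reindexed by \<open>bij_betw_descents\<close> and the pairs of a set
  and a triple are then counted by triples.\<close>

lemma total_occ_length_3:
  assumes "length q = 3" "distinct q"
  shows "total_occ q n = (\<Sum>(l, j, i)\<in>triples n. card {S. S \<subseteq> {..<n - 1} \<and>
     (q ! 0 < q ! 1 \<longleftrightarrow> S \<inter> {i..<j} = {}) \<and>
     (q ! 1 < q ! 2 \<longleftrightarrow> S \<inter> {j..<l} = {}) \<and>
     (q ! 0 < q ! 2 \<longleftrightarrow> S \<inter> {i..<l} = {})})"
proof -
  define P where "P S = (\<lambda>(l, j, i).
     (q ! 0 < q ! 1 \<longleftrightarrow> S \<inter> {i..<j} = {}) \<and>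
     (q ! 1 < q ! 2 \<longleftrightarrow> S \<inter> {j..<l} = {}) \<and>
     (q ! 0 < q ! 2 \<longleftrightarrow> S \<inter> {i..<l} = {}))" for S :: "nat set"
  have "total_occ q n = (\<Sum>\<sigma>\<in>avoiders n. card {t \<in> triples n. P (descents \<sigma>) t})"
    unfolding total_occ_def
  proof (rule sum.cong)
    fix \<sigma> assume \<sigma>: "\<sigma> \<in> avoiders n"
    have "has_order q \<sigma> t \<longleftrightarrow> P (descents \<sigma>) t" if t: "t \<in> triples n" for t
    proof -
      obtain l j i where "t = (l, j, i)" "i < j" "j < l" "l < n"
        using t by (auto simp: triples_def)
      then show ?thesis
        by (simp add: has_order_def P_def avoider_less_iff[OF \<sigma>])
    qed
    then have "{t \<in> triples n. has_order q \<sigma> t} = {t \<in> triples n. P (descents \<sigma>) t}"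
      by blast
    then show "occ_count q \<sigma> = card {t \<in> triples n. P (descents \<sigma>) t}"
      using occ_count_length_3[OF assms, of \<sigma>] \<sigma> by (simp add: avoiders_iff)
  qed simp
  also have "\<dots> = (\<Sum>S\<in>Pow {..<n - 1}. card {t \<in> triples n. P S t})"
    by (rule sum.reindex_bij_betw[OF bij_betw_descents])
  also have "\<dots> = (\<Sum>t\<in>triples n. card {S \<in> Pow {..<n - 1}. P S t})"
    by (rule sum_multicount_gen) auto
  finally show ?thesis
    by (simp add: P_def split_beta)
qed

section \<open>Counting descent sets that meet or miss given intervals\<close>

text \<open>The \<open>m - (b - a)\<close> elements outside the interval are free. The quotient form
  avoids truncated subtraction and lets \<open>2 ^ m\<close> factor out of sums.\<close>

lemma card_disjoint_subsets:
  assumes "a \<le> b" "b \<le> m"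
  shows "real (card {S. S \<subseteq> {..<m} \<and> S \<inter> {a..<b} = {}}) = 2 ^ m * (2 ^ a / 2 ^ b)"
proof -
  have "{S. S \<subseteq> {..<m} \<and> S \<inter> {a..<b} = {}} = Pow ({..<m} - {a..<b})"
    by auto
  moreover have "card ({..<m} - {a..<b}) = m - (b - a)"
    using assms by (subst card_Diff_subset) auto
  ultimately have "real (card {S. S \<subseteq> {..<m} \<and> S \<inter> {a..<b} = {}}) = 2 ^ (m - (b - a))"
    by (simp add: card_Pow)
  also have "\<dots> = 2 ^ m * (2 ^ a / 2 ^ b)"
    using assms by (simp add: power_diff power_add)
  finally show ?thesis .
qed

context
  fixes i j l m :: nat
  assumes ij: "i < j" and jl: "j < l" and lm: "l \<le> m"
begin

text \<open>The interval of the outer pair is the union of the other two, which leaves four cases,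
  one for each of 123, 231, 312 and 321.\<close>

lemma disjoint_ivl_iff: "S \<inter> {i..<l} = {} \<longleftrightarrow> S \<inter> {i..<j} = {} \<and> S \<inter> {j..<l} = {}"
  using ivl_disj_un_two(3)[of i j l, symmetric] ij jl by (simp add: Int_Un_distrib)

lemma card_no_descents:
  "real (card {S. S \<subseteq> {..<m} \<and> S \<inter> {i..<j} = {} \<and> S \<inter> {j..<l} = {}}) = 2 ^ m * (2 ^ i / 2 ^ l)"
  using card_disjoint_subsets[of i l m] ij jl lm by (simp add: disjoint_ivl_iff)

text \<open>The case of 231: sets missing the left interval, minus those missing both.\<close>

lemma card_descent_right:
  "real (card {S. S \<subseteq> {..<m} \<and> S \<inter> {i..<j} = {} \<and> S \<inter> {j..<l} \<noteq> {}}) =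
     2 ^ m * (2 ^ i / 2 ^ j) - 2 ^ m * (2 ^ i / 2 ^ l)"
proof -
  have "card {S. S \<subseteq> {..<m} \<and> S \<inter> {i..<j} = {}} =
      card {S. S \<subseteq> {..<m} \<and> S \<inter> {i..<j} = {} \<and> S \<inter> {j..<l} = {}} +
      card {S. S \<subseteq> {..<m} \<and> S \<inter> {i..<j} = {} \<and> S \<inter> {j..<l} \<noteq> {}}"
    by (subst card_Un_disjoint[symmetric]) (auto intro: arg_cong[where f = card])
  then show ?thesis
    using card_no_descents card_disjoint_subsets[of i j m] ij jl lm by simp
qed

text \<open>The case of 312: sets missing the right interval, minus those missing both.\<close>

lemma card_descent_left:
  "real (card {S. S \<subseteq> {..<m} \<and> S \<inter> {i..<j} \<noteq> {} \<and> S \<inter> {j..<l} = {}}) =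
     2 ^ m * (2 ^ j / 2 ^ l) - 2 ^ m * (2 ^ i / 2 ^ l)"
proof -
  have "card {S. S \<subseteq> {..<m} \<and> S \<inter> {j..<l} = {}} =
      card {S. S \<subseteq> {..<m} \<and> S \<inter> {i..<j} = {} \<and> S \<inter> {j..<l} = {}} +
      card {S. S \<subseteq> {..<m} \<and> S \<inter> {i..<j} \<noteq> {} \<and> S \<inter> {j..<l} = {}}"
    by (subst card_Un_disjoint[symmetric]) (auto intro: arg_cong[where f = card])
  then show ?thesis
    using card_no_descents card_disjoint_subsets[of j l m] ij jl lm by simp
qed

lemma card_descent_both:
  "real (card {S. S \<subseteq> {..<m} \<and> S \<inter> {i..<j} \<noteq> {} \<and> S \<inter> {j..<l} \<noteq> {}}) =
     2 ^ m - 2 ^ m * (2 ^ i / 2 ^ j) - 2 ^ m * (2 ^ j / 2 ^ l) + 2 ^ m * (2 ^ i / 2 ^ l)"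
proof -
  \<comment> \<open>All subsets fall into three classes: the left interval is missed, only the right
    one is missed, or both are met.\<close>
  have "card (Pow {..<m}) =
      card {S. S \<subseteq> {..<m} \<and> S \<inter> {i..<j} = {}} +
      card {S. S \<subseteq> {..<m} \<and> S \<inter> {i..<j} \<noteq> {} \<and> S \<inter> {j..<l} = {}} +
      card {S. S \<subseteq> {..<m} \<and> S \<inter> {i..<j} \<noteq> {} \<and> S \<inter> {j..<l} \<noteq> {}}"
    by (subst card_Un_disjoint[symmetric]; (subst card_Un_disjoint[symmetric])?)
       (auto intro: arg_cong[where f = card])
  from arg_cong[OF this, of real] show ?thesis
    using card_descent_left card_disjoint_subsets[of i j m] ij jl lm by (simp add: card_Pow)
qed

end

section \<open>Closed forms of weighted sums over triples\<close>

lemma sum_power_2: "(\<Sum>i<j. 2 ^ i) = 2 ^ j - (1 :: real)"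
  by (induction j) simp_all

lemma sum_triples_1: "(\<Sum>(l, j, i)\<in>triples n. 1 :: real) = real n * (real n - 1) * (real n - 2) / 6"
proof -
  have inner: "(\<Sum>j<l. real j) = real l * (real l - 1) / 2" for l
    by (induction l) (simp_all add: field_simps)
  have "(\<Sum>(l, j, i)\<in>triples n. 1 :: real) = (\<Sum>l<n. real l * (real l - 1) / 2)"
    unfolding sum_triples by (simp add: inner)
  also have "\<dots> = real n * (real n - 1) * (real n - 2) / 6"
  proof (induction n)
    case (Suc n)
    show ?case
      unfolding sum.lessThan_Suc Suc.IH by (simp add: field_simps)
  qed simp
  finally show ?thesis .
qed

text \<open>The weight is the proportion of descent sets missing \<open>{i..<l}\<close>, so this is
  the mean number of occurrences of 123. The sums over \<open>i\<close> and \<open>j\<close> are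
  geometric up to a linear term; induction handles \<open>l\<close>.\<close>

lemma sum_triples_outer:
  "(\<Sum>(l, j, i)\<in>triples n. 2 ^ i / 2 ^ l :: real) = real n - 4 + (2 * real n + 4) / 2 ^ n"
proof -
  have inner: "(\<Sum>j<l. 2 ^ j - 1 :: real) = 2 ^ l - 1 - real l" for l
    by (simp add: sum_subtractf sum_power_2)
  have "(\<Sum>(l, j, i)\<in>triples n. 2 ^ i / 2 ^ l :: real) = (\<Sum>l<n. (2 ^ l - 1 - real l) / 2 ^ l)"
    by (simp add: sum_triples sum_power_2 inner flip: sum_divide_distrib)
  also have "\<dots> = real n - 4 + (2 * real n + 4) / 2 ^ n"
  proof (induction n)
    case (Suc n)
    show ?case
      unfolding sum.lessThan_Suc Suc.IH by (simp add: field_simps)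
  qed simp
  finally show ?thesis .
qed

lemma sum_triples_left:
  "(\<Sum>(l, j, i)\<in>triples n. 2 ^ i / 2 ^ j :: real) =
     real n * (real n - 1) / 2 - 2 * real n + 4 - 4 / 2 ^ n"
proof -
  have inner: "(\<Sum>j<l. (2 ^ j - 1) / 2 ^ j :: real) = real l - 2 + 2 / 2 ^ l" for l
    by (induction l) (simp_all add: field_simps)
  have "(\<Sum>(l, j, i)\<in>triples n. 2 ^ i / 2 ^ j :: real) = (\<Sum>l<n. real l - 2 + 2 / 2 ^ l)"
    by (simp add: sum_triples sum_power_2 inner flip: sum_divide_distrib)
  also have "\<dots> = real n * (real n - 1) / 2 - 2 * real n + 4 - 4 / 2 ^ n"
  proof (induction n)
    case (Suc n)
    show ?case
      unfolding sum.lessThan_Suc Suc.IH by (simp add: field_simps)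
  qed simp
  finally show ?thesis .
qed

text \<open>Reflecting positions exchanges this sum with that of \<open>sum_triples_left\<close>,
  whence the same value. In both, the sums over \<open>i\<close> and \<open>j\<close> leave
  \<open>real l - 2 + 2 / 2 ^ l\<close>.\<close>

lemma sum_triples_right:
  "(\<Sum>(l, j, i)\<in>triples n. 2 ^ j / 2 ^ l :: real) =
     real n * (real n - 1) / 2 - 2 * real n + 4 - 4 / 2 ^ n"
proof -
  have inner: "(\<Sum>j<l. real j * 2 ^ j) = (real l - 2) * 2 ^ l + 2" for l
    by (induction l) (simp_all add: field_simps)
  have "(\<Sum>(l, j, i)\<in>triples n. 2 ^ j / 2 ^ l :: real) = (\<Sum>l<n. real l - 2 + 2 / 2 ^ l)"
    by (simp add: sum_triples inner add_divide_distrib flip: sum_divide_distrib)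
  also have "\<dots> = real n * (real n - 1) / 2 - 2 * real n + 4 - 4 / 2 ^ n"
  proof (induction n)
    case (Suc n)
    show ?case
      unfolding sum.lessThan_Suc Suc.IH by (simp add: field_simps)
  qed simp
  finally show ?thesis .
qed

section \<open>Totals for the four patterns\<close>

lemma triplesD: "(l, j, i) \<in> triples n \<Longrightarrow> i < j \<and> j < l \<and> l \<le> n - 1"
  by (auto simp: triples_def)

text \<open>Replaces cardinalities by real weights term by term; the bound on \<open>l\<close> is
  the one the counting lemmas require for \<open>m = n - 1\<close>.\<close>

lemma real_sum_triples_cong:
  assumes "\<And>i j l. \<lbrakk>i < j; j < l; l \<le> n - 1\<rbrakk> \<Longrightarrow> real (f l j i) = g l j i"
  shows "real (\<Sum>(l, j, i)\<in>triples n. f l j i) = (\<Sum>(l, j, i)\<in>triples n. g l j i)"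
  unfolding of_nat_sum by (rule sum.cong) (auto dest!: triplesD simp: assms)

lemma total_occ_123:
  "real (total_occ [1, 2, 3] n) = 2 ^ (n - 1) * (\<Sum>(l, j, i)\<in>triples n. 2 ^ i / 2 ^ l)"
proof -
  have "real (total_occ [1, 2, 3] n) =
      (\<Sum>(l, j, i)\<in>triples n. 2 ^ (n - 1) * (2 ^ i / 2 ^ l))"
    \<comment> \<open>\<open>disjoint_ivl_iff\<close> makes the condition on the outer pair a
      consequence of the other two, which leaves the set of \<open>card_no_descents\<close>.\<close>
    by (subst total_occ_length_3, simp, simp, rule real_sum_triples_cong) (simp add: disjoint_ivl_iff card_no_descents cong: conj_cong)
  then show ?thesis
    by (simp add: sum_distrib_left split_beta)
qed

lemma total_occ_231:
  "real (total_occ [2, 3, 1] n) = 2 ^ (n - 1) *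
     ((\<Sum>(l, j, i)\<in>triples n. 2 ^ i / 2 ^ j) - (\<Sum>(l, j, i)\<in>triples n. 2 ^ i / 2 ^ l))"
proof -
  have "real (total_occ [2, 3, 1] n) =
      (\<Sum>(l, j, i)\<in>triples n. 2 ^ (n - 1) * (2 ^ i / 2 ^ j) - 2 ^ (n - 1) * (2 ^ i / 2 ^ l))"
    by (subst total_occ_length_3, simp, simp, rule real_sum_triples_cong) (simp add: disjoint_ivl_iff card_descent_right cong: conj_cong)
  then show ?thesis
    by (simp add: sum_distrib_left sum_subtractf right_diff_distrib split_beta)
qed

lemma total_occ_312:
  "real (total_occ [3, 1, 2] n) = 2 ^ (n - 1) *
     ((\<Sum>(l, j, i)\<in>triples n. 2 ^ j / 2 ^ l) - (\<Sum>(l, j, i)\<in>triples n. 2 ^ i / 2 ^ l))"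
proof -
  have "real (total_occ [3, 1, 2] n) =
      (\<Sum>(l, j, i)\<in>triples n. 2 ^ (n - 1) * (2 ^ j / 2 ^ l) - 2 ^ (n - 1) * (2 ^ i / 2 ^ l))"
    by (subst total_occ_length_3, simp, simp, rule real_sum_triples_cong) (simp add: disjoint_ivl_iff card_descent_left cong: conj_cong)
  then show ?thesis
    by (simp add: sum_distrib_left sum_subtractf right_diff_distrib split_beta)
qed

lemma total_occ_321:
  "real (total_occ [3, 2, 1] n) = 2 ^ (n - 1) *
     ((\<Sum>(l, j, i)\<in>triples n. 1) - (\<Sum>(l, j, i)\<in>triples n. 2 ^ i / 2 ^ j)
      - (\<Sum>(l, j, i)\<in>triples n. 2 ^ j / 2 ^ l) + (\<Sum>(l, j, i)\<in>triples n. 2 ^ i / 2 ^ l))"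
proof -
  have "real (total_occ [3, 2, 1] n) =
      (\<Sum>(l, j, i)\<in>triples n. 2 ^ (n - 1) - 2 ^ (n - 1) * (2 ^ i / 2 ^ j)
        - 2 ^ (n - 1) * (2 ^ j / 2 ^ l) + 2 ^ (n - 1) * (2 ^ i / 2 ^ l))"
    by (subst total_occ_length_3, simp, simp, rule real_sum_triples_cong) (simp add: disjoint_ivl_iff card_descent_both cong: conj_cong)
  then show ?thesis
    by (simp add: sum_distrib_left sum_subtractf sum.distrib algebra_simps split_beta)
qed

theorem theorem2p10:
  fixes n :: nat
  assumes "n \<ge> 3"
  shows "real (total_occ [1,2,3] n) = (real n - 4) * 2 ^ (n - 1) + real n + 2 \<and>
         total_occ [2,3,1] n = total_occ [3,1,2] n \<and>
         real (total_occ [3,1,2] n) =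
           ((real n)^2 - 7 * real n + 16) * 2 ^ (n - 2) - real n - 4 \<and>
         real (total_occ [3,2,1] n) =
           ((real n)^3 / 3 - 3 * (real n)^2 + 38 * real n / 3 - 24) * 2 ^ (n - 2) + real n + 6"
proof -
  \<comment> \<open>Makes the exponents \<open>n - 1\<close> and \<open>n - 2\<close> into
    \<open>m + 1\<close> and \<open>m\<close>, free of truncated subtraction.\<close>
  define m where "m = n - 2"
  have n: "n = m + 2"
    using assms by (simp add: m_def)
  note sums = sum_triples_1 sum_triples_outer sum_triples_left sum_triples_right
  \<comment> \<open>Both totals subtract the same outer sum, and the left and right sums have one
    closed form.\<close>
  have "real (total_occ [2,3,1] n) = real (total_occ [3,1,2] n)"
    unfolding total_occ_231 total_occ_312 sums ..
  then have "total_occ [2,3,1] n = total_occ [3,1,2] n"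
    by (rule of_nat_eq_iff[THEN iffD1])
  then show ?thesis
    unfolding total_occ_123 total_occ_312 total_occ_321 sums
    by (intro conjI) (simp_all add: n field_simps power2_eq_square power3_eq_cube)
qed

end
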